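(* Let $C\subset\mathbb{R}^n$ be nonempty, closed and convex, and let $T(y)=My+q$, where $M\in\mathbb{R}^{n\times n}$, $q\in\mathbb{R}^n$ and $\tfrac12(M+M^\top)\succeq0$ (positive semidefinite). Then $T$ is monotone. For each fixed $x\in\mathbb{R}^n$, the problem $$\max_{y\in C}\langle My+q,\,x-y\rangle$$ is equivalent, up to the constant $q^\top x$, to the convex optimisation problem $$\min_{y\in C}\ f_x(y),\qquad f_x(y):=\tfrac12\,y^\top(M+M^\top)y+(q-M^\top x)^\top y,$$ that is, $f_x$ is convex and $\langle My+q,x-y\rangle=q^\top x-f_x(y)$ for all $y$, so that the two problems have the same solutions. In particular, if $M=A^\top A+S$ with $A$ a real matrix with $n$ columns and $S^\top=-S$, then the minimisation problem becomes $$\min_{y\in C}\left\{y^\top A^\top A\,y+\big(q-(A^\top A-S)x\big)^\top y\right\}.$$ *)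

theory Defs
  imports "HOL-Analysis.Analysis"
begin

(* Symmetry is part of the notion, as usual for the Loewner order. *)
definition pos_semidef :: "real ^ 'n ^ 'n \<Rightarrow> bool" where
  "pos_semidef B \<longleftrightarrow> transpose B = B \<and> (\<forall>v. 0 \<le> v \<bullet> (B *v v))"

(* Monotonicity in the sense of operator theory and variational inequalities,
   not the order-theoretic mono. *)
definition monotone_operator :: "('a::real_inner \<Rightarrow> 'a) \<Rightarrow> bool" where
  "monotone_operator T \<longleftrightarrow> (\<forall>y z. 0 \<le> (T y - T z) \<bullet> (y - z))"

definition affine_op :: "real ^ 'n ^ 'n \<Rightarrow> real ^ 'n \<Rightarrow> real ^ 'n \<Rightarrow> real ^ 'n" where
  "affine_op M q y = M *v y + q"

definition quad_obj ::
    "real ^ 'n ^ 'n \<Rightarrow> real ^ 'n \<Rightarrow> real ^ 'n \<Rightarrow> real ^ 'n \<Rightarrow> real" where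
  "quad_obj M q x y =
     1 / 2 * (y \<bullet> ((M + transpose M) *v y)) + (q - transpose M *v x) \<bullet> y"

definition argmax_set :: "('a \<Rightarrow> real) \<Rightarrow> 'a set \<Rightarrow> 'a set" where
  "argmax_set g C = {y. is_arg_max g (\<lambda>z. z \<in> C) y}"

definition argmin_set :: "('a \<Rightarrow> real) \<Rightarrow> 'a set \<Rightarrow> 'a set" where
  "argmin_set g C = {y. is_arg_min g (\<lambda>z. z \<in> C) y}"

end

(* Everything rests on the identity f_x(y) = y . M y + q . y - x . M y. The form y . M y only
   sees the symmetric part of M, so it is nonnegative when that part is positive semidefinite, and
   the convexity defect of f_x between y and z is t (1 - t) times its value at y - z. *)

theory Submission
  imports Defs
begin

lemma inner_transpose_matrix_vector:
  fixes M :: "real ^ 'n ^ 'm"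
  shows "(transpose M *v x) \<bullet> y = x \<bullet> (M *v y)"
  by (simp add: dot_lmul_matrix)

text \<open>\<open>M\<close> and its transpose have the same quadratic form, since
  \<open>transpose M\<close> moves across the inner product. This absorbs the factor 1/2 in
  \<open>quad_obj\<close>.\<close>

lemma inner_add_transpose:
  fixes M :: "real ^ 'n ^ 'n"
  shows "y \<bullet> ((M + transpose M) *v y) = 2 * (y \<bullet> (M *v y))"
  using inner_transpose_matrix_vector[of M y y]
  by (simp only: matrix_vector_mult_add_rdistrib inner_add_right inner_commute[of y "transpose M *v y"])

lemma transpose_add:
  fixes A B :: "'a::ab_group_add ^ 'n ^ 'm"
  shows "transpose (A + B) = transpose A + transpose B"
  by (simp add: transpose_def vec_eq_iff)

text \<open>The symmetry demanded by \<open>pos_semidef\<close> is automatic for a symmetric part,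
  so only the sign of the form of \<open>M\<close> itself remains. Later arguments use the
  hypothesis in this shape.\<close>

lemma pos_semidef_symmetric_part_iff:
  fixes M :: "real ^ 'n ^ 'n"
  shows "pos_semidef ((1 / 2) *\<^sub>R (M + transpose M)) \<longleftrightarrow> (\<forall>v. 0 \<le> v \<bullet> (M *v v))"
proof -
  have "transpose ((1 / 2) *\<^sub>R (M + transpose M)) = (1 / 2) *\<^sub>R (M + transpose M)"
    by (simp add: transpose_def vec_eq_iff)
  moreover have "v \<bullet> (((1 / 2) *\<^sub>R (M + transpose M)) *v v) = v \<bullet> (M *v v)" for v
    using inner_add_transpose[of v M]
    by (simp add: scaleR_matrix_vector_assoc[symmetric])
  ultimately show ?thesis
    unfolding pos_semidef_def by simp
qed

lemma monotone_affine_op: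
  assumes "\<And>v. 0 \<le> v \<bullet> (M *v v)"
  shows "monotone_operator (affine_op M q)"
  unfolding monotone_operator_def affine_op_def
  using assms by (simp add: matrix_vector_mult_diff_distrib[symmetric] inner_commute)

lemma quad_obj_eq: "quad_obj M q x y = y \<bullet> (M *v y) + q \<bullet> y - x \<bullet> (M *v y)"
  unfolding quad_obj_def inner_add_transpose inner_diff_left inner_transpose_matrix_vector by simp

lemma convex_quad_obj:
  assumes "\<And>v. 0 \<le> v \<bullet> (M *v v)"
  shows "convex_on UNIV (quad_obj M q x)"
proof (rule convex_onI)
  fix t :: real and y z
  assume t: "0 < t" "t < 1"
  \<comment> \<open>The terms affine in the argument cancel. The cross terms
    \<open>y \<bullet> (M *v z)\<close> and \<open>z \<bullet> (M *v y)\<close> each keep the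
    coefficient \<open>- t * (1 - t)\<close>, and the two squares keep
    \<open>t * (1 - t)\<close>.\<close>
  have "(1 - t) * quad_obj M q x y + t * quad_obj M q x z - quad_obj M q x ((1 - t) *\<^sub>R y + t *\<^sub>R z)
      = t * (1 - t) * ((y - z) \<bullet> (M *v (y - z)))"
    unfolding quad_obj_eq
    by (simp add: matrix_vector_right_distrib matrix_vector_mult_diff_distrib
        matrix_vector_mult_scaleR inner_simps) (simp add: algebra_simps)
  moreover have "0 \<le> t * (1 - t) * ((y - z) \<bullet> (M *v (y - z)))"
    using t assms by simp
  ultimately show "quad_obj M q x ((1 - t) *\<^sub>R y + t *\<^sub>R z)
      \<le> (1 - t) * quad_obj M q x y + t * quad_obj M q x z"
    by linarith
qed simp

lemma affine_op_inner_eq: "affine_op M q y \<bullet> (x - y) = q \<bullet> x - quad_obj M q x y"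
  unfolding quad_obj_eq affine_op_def
  by (simp add: inner_simps inner_commute)

text \<open>Both notions say that no point of \<open>C\<close> is strictly better, and subtracting
  from a constant reverses strict inequalities. Existence of an optimum is not claimed: both sets
  may be empty.\<close>

lemma argmax_set_const_minus:
  fixes f :: "'a \<Rightarrow> real"
  shows "argmax_set (\<lambda>y. c - f y) C = argmin_set f C"
  unfolding argmax_set_def argmin_set_def is_arg_max_def is_arg_min_def by simp

lemma argmax_affine_op:
  "argmax_set (\<lambda>y. affine_op M q y \<bullet> (x - y)) C = argmin_set (quad_obj M q x) C"
  unfolding affine_op_inner_eq by (rule argmax_set_const_minus)

lemma transpose_gram:
  fixes A :: "real ^ 'n ^ 'm"
  shows "transpose (transpose A ** A) = transpose A ** A"
  by (simp add: matrix_transpose_mul)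

lemma transpose_gram_plus_skew:
  fixes A :: "real ^ 'n ^ 'm"
  assumes "transpose S = - S"
  shows "transpose (transpose A ** A + S) = transpose A ** A - S"
  using assms by (simp add: transpose_add transpose_gram)

text \<open>Adding the transpose cancels \<open>S\<close> and leaves twice the Gram matrix, so both
  forms have the same double.\<close>

lemma inner_gram_plus_skew:
  fixes A :: "real ^ 'n ^ 'm"
  assumes "transpose S = - S"
  shows "y \<bullet> ((transpose A ** A + S) *v y) = y \<bullet> ((transpose A ** A) *v y)"
  using inner_add_transpose[of y "transpose A ** A + S"] inner_add_transpose[of y "transpose A ** A"]
  by (simp add: transpose_gram_plus_skew[OF assms] transpose_gram)

text \<open>The form is the squared norm of \<open>A *v y\<close>, which is where positive
  semidefiniteness comes from in the special case.\<close>

lemma inner_gram: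
  fixes A :: "real ^ 'n ^ 'm"
  shows "y \<bullet> ((transpose A ** A) *v y) = (A *v y) \<bullet> (A *v y)"
  using inner_transpose_matrix_vector[of A "A *v y" y]
  by (simp only: matrix_vector_mul_assoc inner_commute)

text \<open>The skew part drops out of the quadratic term and survives only in the linear one, with
  its sign flipped by the transpose.\<close>

lemma quad_obj_gram_plus_skew:
  fixes A :: "real ^ 'n ^ 'm"
  assumes "transpose S = - S"
  shows "quad_obj (transpose A ** A + S) q x y =
    y \<bullet> ((transpose A ** A) *v y) + (q - (transpose A ** A - S) *v x) \<bullet> y"
  \<comment> \<open>The sum \<open>M + transpose M\<close> is collapsed first, while its pattern is
    still visible; only then is the remaining transpose evaluated.\<close>
  unfolding quad_obj_def inner_add_transpose
  unfolding inner_gram_plus_skew[OF assms] transpose_gram_plus_skew[OF assms] by simp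

theorem proposition6p4:
  fixes C :: "(real ^ 'n) set"
    and M S :: "real ^ 'n ^ 'n"
    and q :: "real ^ 'n"
    and A :: "real ^ 'n ^ 'm"
  assumes "C \<noteq> {}" and "closed C" and "convex C"
  shows
    "(pos_semidef ((1 / 2) *\<^sub>R (M + transpose M)) \<longrightarrow>
        monotone_operator (affine_op M q) \<and>
        (\<forall>x. convex_on UNIV (quad_obj M q x) \<and>
             (\<forall>y. affine_op M q y \<bullet> (x - y) = q \<bullet> x - quad_obj M q x y) \<and>
             argmax_set (\<lambda>y. affine_op M q y \<bullet> (x - y)) C = argmin_set (quad_obj M q x) C)) \<and>
     (M = transpose A ** A + S \<and> transpose S = - S \<longrightarrow>
        pos_semidef ((1 / 2) *\<^sub>R (M + transpose M)) \<and>
        (\<forall>x. (\<forall>y. quad_obj M q x y =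
                    y \<bullet> ((transpose A ** A) *v y) + (q - (transpose A ** A - S) *v x) \<bullet> y) \<and>
             argmax_set (\<lambda>y. affine_op M q y \<bullet> (x - y)) C =
               argmin_set (\<lambda>y. y \<bullet> ((transpose A ** A) *v y)
                                + (q - (transpose A ** A - S) *v x) \<bullet> y) C))"
proof (intro conjI impI)
  assume "pos_semidef ((1 / 2) *\<^sub>R (M + transpose M))"
  then have pos: "0 \<le> v \<bullet> (M *v v)" for v
    by (simp add: pos_semidef_symmetric_part_iff)
  show "monotone_operator (affine_op M q)"
    using pos by (rule monotone_affine_op)
  show "\<forall>x. convex_on UNIV (quad_obj M q x) \<and>
      (\<forall>y. affine_op M q y \<bullet> (x - y) = q \<bullet> x - quad_obj M q x y) \<and>
      argmax_set (\<lambda>y. affine_op M q y \<bullet> (x - y)) C = argmin_set (quad_obj M q x) C"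
    using convex_quad_obj[OF pos] affine_op_inner_eq argmax_affine_op by blast
next
  assume "M = transpose A ** A + S \<and> transpose S = - S"
  then have M: "M = transpose A ** A + S" and S: "transpose S = - S"
    by auto
  show "pos_semidef ((1 / 2) *\<^sub>R (M + transpose M))"
    unfolding pos_semidef_symmetric_part_iff M inner_gram_plus_skew[OF S] inner_gram by simp
  show "\<forall>x. (\<forall>y. quad_obj M q x y =
        y \<bullet> ((transpose A ** A) *v y) + (q - (transpose A ** A - S) *v x) \<bullet> y) \<and>
      argmax_set (\<lambda>y. affine_op M q y \<bullet> (x - y)) C =
        argmin_set (\<lambda>y. y \<bullet> ((transpose A ** A) *v y)
                         + (q - (transpose A ** A - S) *v x) \<bullet> y) C"
    \<comment> \<open>\<open>abs_def\<close> gives an equation between functions, which also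
      rewrites the unapplied objective under \<open>argmin_set\<close>.\<close>
    unfolding M argmax_affine_op quad_obj_gram_plus_skew[OF S, abs_def] by simp
qed

end
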